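(* Let $m,n\ge 2$ be integers, $\mathcal{A}\in\mathbb{R}^{[m,n]}$ and $a\in\mathbb{R}^n$. If the solution map $\mathrm{Sol}:\mathbb{R}^{[m,n]}\times\mathbb{R}^n\rightrightarrows\mathbb{R}^n$ is lower semicontinuous at $(\mathcal{A},a)$, then $\mathrm{Sol}(\mathcal{A},a)$ has finitely many elements. Hence, if $\dim\mathrm{Sol}(\mathcal{A},a)\ge 1$, then $\mathrm{Sol}$ is not lower semicontinuous at $(\mathcal{A},a)$.
   Context: $\mathbb{R}^{[m,n]}\cong\mathbb{R}^{n^m}$ is the real vector space of real $m$-th order $n$-dimensional tensors $\mathcal{A}=(a_{i_1\cdots i_m})$, $i_j\in[n]=\{1,\dots,n\}$, with the Frobenius norm; $\mathbb{R}^{[m,n]}\times\mathbb{R}^n$ carries the Euclidean norm. For $x\in\mathbb{R}^n$, $\mathcal{A}x^{m-1}\in\mathbb{R}^n$ has components $(\mathcal{A}x^{m-1})_i=\sum_{i_2,\dots,i_m=1}^n a_{ii_2\cdots i_m}x_{i_2}\cdots x_{i_m}$, and $\mathcal{A}x^m=\langle x,\mathcal{A}x^{m-1}\rangle$. For $a\in\mathbb{R}^n$, $\mathrm{Sol}(\mathcal{A},a)$ is the solution set of the tensor complementarity problem $\mathrm{TCP}(\mathcal{A},a)$, i.e. the set of $x\in\mathbb{R}^n$ with $x\ge 0$, $\mathcal{A}x^{m-1}+a\ge 0$, $\mathcal{A}x^m+\langle x,a\rangle=0$ (inequalities componentwise); it is a semi-algebraic set. The solution map is the set-valued map $(\mathcal{A},a)\mapsto\mathrm{Sol}(\mathcal{A},a)$.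 A set-valued map $\Psi$ into $\mathbb{R}^n$ is lower semicontinuous at $\bar x$ if $\Psi(\bar x)=\liminf_{x\to\bar x}\Psi(x)$, where $\liminf_{x\to\bar x}\Psi(x)=\{u\in\mathbb{R}^n: \forall x^k\to\bar x,\ \exists u^k\to u \text{ with } u^k\in\Psi(x^k)\}$. A semi-algebraic set $S$ (a finite union of sets defined by finitely many polynomial equations and strict inequalities) is a finite disjoint union of semi-algebraic sets $S_i$, each semi-algebraically diffeomorphic to $(0,1)^{d_i}$ (with $(0,1)^0$ a point), and $\dim S:=\max_i d_i$. *)

theory Defs
  imports "HOL-Analysis.Analysis"
begin

section \<open>Tensors and the tensor complementarity problem\<close>

text \<open>
  The order of a tensor is \<open>CARD('m)\<close> and its dimension is \<open>CARD('n)\<close>. An entry is indexed by the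
  multi-index \<open>j\<close> of type \<open>'n ^ 'm\<close>, whose component \<open>j $ l\<close> is the index in position \<open>l\<close>. The
  positions are linearly ordered, so that the first position is \<open>Min UNIV\<close>. The Euclidean norm of
  \<open>real ^ ('n ^ 'm)\<close> is the Frobenius norm.
\<close>

type_synonym ('m, 'n) tensor = "real ^ ('n ^ 'm)"

definition first_pos :: "'m::{finite,linorder}" where
  "first_pos = Min UNIV"

definition tensor_apply :: "('m::{finite,linorder}, 'n::finite) tensor \<Rightarrow> real ^ 'n \<Rightarrow> real ^ 'n" where
  "tensor_apply A x =
     (\<chi> i. \<Sum>j | j $ first_pos = i. A $ j * (\<Prod>l\<in>UNIV - {first_pos}. x $ (j $ l)))"

definition tensor_form :: "('m::{finite,linorder}, 'n::finite) tensor \<Rightarrow> real ^ 'n \<Rightarrow> real" where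
  "tensor_form A x = x \<bullet> tensor_apply A x"

definition Sol :: "('m::{finite,linorder}, 'n::finite) tensor \<times> (real ^ 'n) \<Rightarrow> (real ^ 'n) set" where
  "Sol = (\<lambda>(A, a). {x. (\<forall>i. 0 \<le> x $ i) \<and> (\<forall>i. 0 \<le> (tensor_apply A x + a) $ i) \<and>
                        tensor_form A x + x \<bullet> a = 0})"


section \<open>Lower semicontinuity of set-valued maps\<close>

text \<open>
  As usual for the Painleve--Kuratowski lower limit, \<open>u k \<in> \<Psi> (X k)\<close> is required for all
  sufficiently large \<open>k\<close>. Requiring it for every \<open>k\<close> would make the lower limit empty whenever
  \<open>\<Psi>\<close> has an empty value anywhere.
\<close>

definition set_liminf :: "('a::topological_space \<Rightarrow> 'b::topological_space set) \<Rightarrow> 'a \<Rightarrow> 'b set" where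
  "set_liminf \<Psi> x =
     {v. \<forall>X. X \<longlonglongrightarrow> x \<longrightarrow> (\<exists>u. u \<longlonglongrightarrow> v \<and> (\<forall>\<^sub>F k in sequentially. u k \<in> \<Psi> (X k)))}"

definition lower_semicontinuous_at ::
    "('a::topological_space \<Rightarrow> 'b::topological_space set) \<Rightarrow> 'a \<Rightarrow> bool" where
  "lower_semicontinuous_at \<Psi> x \<longleftrightarrow> \<Psi> x = set_liminf \<Psi> x"


section \<open>Semi-algebraic sets and their dimension\<close>

definition basic_semialgebraic :: "'a::euclidean_space set \<Rightarrow> bool" where
  "basic_semialgebraic S \<longleftrightarrow>
     (\<exists>E G. finite E \<and> finite G \<and> (\<forall>p\<in>E \<union> G. real_polynomial_function p) \<and>
            S = {x. (\<forall>p\<in>E. p x = 0) \<and> (\<forall>p\<in>G. 0 < p x)})"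

definition semialgebraic :: "'a::euclidean_space set \<Rightarrow> bool" where
  "semialgebraic S \<longleftrightarrow> (\<exists>F. finite F \<and> (\<forall>T\<in>F. basic_semialgebraic T) \<and> S = \<Union>F)"

text \<open>\<open>Ck_on k f U\<close> means that \<open>f\<close> is of class \<open>C\<^sup>k\<close> on \<open>U\<close>; it is meant for open \<open>U\<close>.\<close>

primrec Ck_on ::
    "nat \<Rightarrow> ('a::euclidean_space \<Rightarrow> 'b::euclidean_space) \<Rightarrow> 'a set \<Rightarrow> bool" where
  "Ck_on 0 f U \<longleftrightarrow> continuous_on U f"
| "Ck_on (Suc k) f U \<longleftrightarrow>
     (\<forall>x\<in>U. f differentiable at x) \<and> (\<forall>v. Ck_on k (\<lambda>x. frechet_derivative f (at x) v) U)"

text \<open>Smoothness on an arbitrary subset: local extendability to \<open>C\<^sup>\<infinity>\<close> maps on open sets.\<close>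

definition smooth_map_on ::
    "'a::euclidean_space set \<Rightarrow> ('a \<Rightarrow> 'b::euclidean_space) \<Rightarrow> bool" where
  "smooth_map_on X f \<longleftrightarrow>
     (\<forall>x\<in>X. \<exists>U F. open U \<and> x \<in> U \<and> (\<forall>k. Ck_on k F U) \<and> (\<forall>y\<in>U \<inter> X. F y = f y))"

definition semialgebraic_diffeomorphic ::
    "'a::euclidean_space set \<Rightarrow> 'b::euclidean_space set \<Rightarrow> bool" where
  "semialgebraic_diffeomorphic X Y \<longleftrightarrow>
     (\<exists>f g. f ` X = Y \<and> g ` Y = X \<and> (\<forall>x\<in>X. g (f x) = x) \<and> (\<forall>y\<in>Y. f (g y) = y) \<and>
            smooth_map_on X f \<and> smooth_map_on Y g \<and>
            semialgebraic ((\<lambda>x. (x, f x)) ` X) \<and> semialgebraic ((\<lambda>y. (y, g y)) ` Y))"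

text \<open>
  The cube \<open>(0,1)\<^sup>d\<close> is realised inside the ambient Euclidean space, along the \<open>d = card B\<close>
  coordinate directions in \<open>B\<close>; \<open>open_cube {} = {0}\<close> is a point. Restricting to \<open>d \<le> DIM('a)\<close> loses
  nothing, since by invariance of domain no cube of larger dimension embeds in the ambient space.
\<close>

definition open_cube :: "'a::euclidean_space set \<Rightarrow> 'a set" where
  "open_cube B = {x. \<forall>b\<in>Basis. if b \<in> B then 0 < x \<bullet> b \<and> x \<bullet> b < 1 else x \<bullet> b = 0}"

definition semialgebraic_cell :: "'a::euclidean_space set \<Rightarrow> nat \<Rightarrow> bool" where
  "semialgebraic_cell (T :: 'a set) d \<longleftrightarrow> semialgebraic T \<and>
     (\<exists>B\<subseteq>(Basis :: 'a set). card B = d \<and> semialgebraic_diffeomorphic T (open_cube B))"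

definition cell_decomposition ::
    "'a::euclidean_space set \<Rightarrow> 'a set set \<Rightarrow> ('a set \<Rightarrow> nat) \<Rightarrow> bool" where
  "cell_decomposition S P d \<longleftrightarrow>
     finite P \<and> disjoint P \<and> \<Union>P = S \<and> (\<forall>T\<in>P. semialgebraic_cell T (d T))"

text \<open>
  The maximal cell dimension is the same for every cell decomposition of a nonempty
  semi-algebraic set, hence the definite description. The empty set has no cells and gets
  dimension \<open>-1\<close>.
\<close>

definition semialgebraic_dim :: "'a::euclidean_space set \<Rightarrow> int" where
  "semialgebraic_dim S =
     (if S = {} then -1
      else int (THE k. \<exists>P d. cell_decomposition S P d \<and> k = Max (d ` P)))"

end

theory Submission
  imports Defs "Jordan_Normal_Form.Char_Poly"
begin

text \<open>
  Perturb \<open>A\<close> to \<open>A + t I\<close> with \<open>I\<close> the diagonal tensor. Complementarity forces every solution to satisfy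
  \<open>t x\<^sub>i\<^sup>m = q\<^sub>i(x)\<close> for each \<open>i\<close>, where \<open>q\<^sub>i\<close> has degree at most \<open>m\<close> and does not depend on \<open>t\<close>. Among
  the monomials of bounded degree, let \<open>b\<close> collect those with some exponent \<open>\<ge> m\<close> and \<open>s\<close> the others. The
  equations give \<open>t b = C b + D s\<close>, so \<open>b\<close> is a linear function of \<open>s\<close> unless \<open>t\<close> is one of the finitely many
  eigenvalues of \<open>C\<close>. Multiplication by \<open>x\<^sub>i\<close> is then a linear map on \<open>s\<close>, hence \<open>x\<^sub>i\<close> is an eigenvalue of a
  fixed matrix of size \<open>m\<^sup>n\<close>. The number of solutions is therefore bounded uniformly in almost all \<open>t\<close>, and
  lower semicontinuity carries this bound over to the limit \<open>t \<longlongrightarrow> 0\<close>.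
\<close>

section \<open>Eigenvalues and resolvents of real matrices over a finite index set\<close>

no_notation vec_index (infixl \<open>$\<close> 100)
no_notation scalar_prod (infix \<open>\<bullet>\<close> 70)

text \<open>A matrix is a function of two indices from \<open>I\<close>, so that monomial exponents
  can serve as row and column labels. Only the values of \<open>M\<close> and \<open>v\<close> on
  \<open>I\<close> matter.\<close>

definition eigenvalues_on :: "'i set \<Rightarrow> ('i \<Rightarrow> 'i \<Rightarrow> real) \<Rightarrow> real set" where
  "eigenvalues_on I M =
     {c. \<exists>v. (\<exists>i\<in>I. v i \<noteq> 0) \<and> (\<forall>i\<in>I. (\<Sum>j\<in>I. M i j * v j) = c * v i)}"

lemma mat_mult_vec_reindex:
  assumes h: "bij_betw h {..<n} I" and i: "i < n"
  shows "vec_index (mat n n (\<lambda>(i, j). M (h i) (h j)) *\<^sub>v vec n (\<lambda>i. v (h i))) i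
           = (\<Sum>j\<in>I. (M (h i) j :: real) * v j)"
proof -
  have "vec_index (mat n n (\<lambda>(i, j). M (h i) (h j)) *\<^sub>v vec n (\<lambda>i. v (h i))) i
          = (\<Sum>j<n. M (h i) (h j) * v (h j))"
    using i by (simp add: mult_mat_vec_def scalar_prod_def row_def lessThan_atLeast0)
  also have "\<dots> = (\<Sum>j\<in>I. M (h i) j * v j)"
    by (rule sum.reindex_bij_betw[OF h])
  finally show ?thesis .
qed

text \<open>Numbering \<open>I\<close> by \<open>h\<close> turns the matrix into one with indices
  below \<open>n\<close>, for which characteristic polynomials and determinants are
  available.\<close>

lemma eigenvalues_on_reindex:
  assumes h: "bij_betw h {..<n} I"
  shows "eigenvalues_on I M = {c. eigenvalue (mat n n (\<lambda>(i, j). M (h i) (h j))) c}"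
proof (intro equalityI subsetI)
  let ?A = "mat n n (\<lambda>(i, j). M (h i) (h j))"
  fix c assume "c \<in> eigenvalues_on I M"
  then obtain v where v: "\<exists>i\<in>I. v i \<noteq> 0" "\<forall>i\<in>I. (\<Sum>j\<in>I. M i j * v j) = c * v i"
    unfolding eigenvalues_on_def by auto
  let ?v = "vec n (\<lambda>i. v (h i))"
  obtain i where i: "i < n" "v (h i) \<noteq> 0"
    using v(1) h by (auto simp: bij_betw_def)
  have "?v \<noteq> 0\<^sub>v n"
    using i by (metis index_vec index_zero_vec(1))
  moreover have "?A *\<^sub>v ?v = c \<cdot>\<^sub>v ?v"
  proof (rule eq_vecI)
    fix i assume "i < dim_vec (c \<cdot>\<^sub>v ?v)"
    then have i: "i < n" by simp
    then have "h i \<in> I" using h by (auto simp: bij_betw_def)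
    then show "vec_index (?A *\<^sub>v ?v) i = vec_index (c \<cdot>\<^sub>v ?v) i"
      using i v(2) mat_mult_vec_reindex[OF h i, of M v] by simp
  qed simp
  ultimately show "c \<in> {c. eigenvalue ?A c}"
    by (auto simp: eigenvalue_def eigenvector_def intro!: exI[of _ ?v])
next
  let ?A = "mat n n (\<lambda>(i, j). M (h i) (h j))"
  fix c assume "c \<in> {c. eigenvalue ?A c}"
  then obtain w where w: "w \<in> carrier_vec n" "w \<noteq> 0\<^sub>v n" "?A *\<^sub>v w = c \<cdot>\<^sub>v w"
    by (auto simp: eigenvalue_def eigenvector_def)
  define v where "v i = vec_index w (inv_into {..<n} h i)" for i
  have vh: "v (h i) = vec_index w i" if "i < n" for i
    using that h by (simp add: v_def bij_betw_def)
  have wv: "w = vec n (\<lambda>i. v (h i))"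
    using w(1) by (intro eq_vecI) (auto simp: vh)
  obtain i where "i < n" "vec_index w i \<noteq> 0"
    using w(1,2) by (metis carrier_vecD eq_vecI index_zero_vec)
  then have "\<exists>i\<in>I. v i \<noteq> 0"
    using h vh by (metis bij_betw_apply lessThan_iff)
  moreover have "(\<Sum>j\<in>I. M i j * v j) = c * v i" if "i \<in> I" for i
  proof -
    obtain k where k: "k < n" "i = h k"
      using \<open>i \<in> I\<close> h by (auto simp: bij_betw_def)
    have "(\<Sum>j\<in>I. M i j * v j) = vec_index (?A *\<^sub>v w) k"
      using mat_mult_vec_reindex[OF h k(1), of M v] k(2) wv by simp
    also have "\<dots> = c * v i"
      using w(1) k by (simp add: w(3) vh)
    finally show ?thesis .
  qed
  ultimately show "c \<in> eigenvalues_on I M"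
    unfolding eigenvalues_on_def by blast
qed

text \<open>The eigenvalues are the roots of the characteristic polynomial, which is monic of degree
  \<open>card I\<close>.\<close>

lemma eigenvalues_on_bound:
  assumes "finite I"
  shows "finite (eigenvalues_on I M)" and "card (eigenvalues_on I M) \<le> card I"
proof -
  obtain h where h: "bij_betw h {..<card I} I"
    using ex_bij_betw_nat_finite[OF assms] by (auto simp: lessThan_atLeast0)
  let ?A = "mat (card I) (card I) (\<lambda>(i, j). M (h i) (h j))"
  have A: "?A \<in> carrier_mat (card I) (card I)" by simp
  have p: "degree (char_poly ?A) = card I" "char_poly ?A \<noteq> 0"
    using degree_monic_char_poly[OF A] by auto
  have eq: "eigenvalues_on I M = {c. poly (char_poly ?A) c = 0}"
    unfolding eigenvalues_on_reindex[OF h] eigenvalue_root_char_poly[OF A] ..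
  show "finite (eigenvalues_on I M)"
    unfolding eq by (rule poly_roots_finite[OF p(2)])
  show "card (eigenvalues_on I M) \<le> card I"
    unfolding eq using card_poly_roots_bound[OF p(2)] p(1) by simp
qed

text \<open>\<open>G\<close> is the inverse of \<open>t\<close> times the identity minus
  \<open>M\<close>, which exists because \<open>t\<close> is no eigenvalue. It is fixed before
  \<open>b\<close> and \<open>r\<close>, so one \<open>G\<close> serves all solutions of the
  system.\<close>

lemma resolvent_on:
  assumes "finite I" and t: "t \<notin> eigenvalues_on I M"
  shows "\<exists>G. \<forall>b r. (\<forall>i\<in>I. t * b i = (\<Sum>j\<in>I. M i j * b j) + r i) \<longrightarrow>
                   (\<forall>i\<in>I. b i = (\<Sum>j\<in>I. G i j * r j))"
proof -
  obtain h where h: "bij_betw h {..<card I} I"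
    using ex_bij_betw_nat_finite[OF assms(1)] by (auto simp: lessThan_atLeast0)
  define n where "n = card I"
  note h = h[folded n_def]
  define M' where "M' i j = (if i = j then t else 0) - M i j" for i j
  let ?A = "mat n n (\<lambda>(i, j). M' (h i) (h j))"
  have A: "?A \<in> carrier_mat n n" by simp
  have inj: "h i = h j \<longleftrightarrow> i = j" if "i < n" "j < n" for i j
    using that h by (auto simp: bij_betw_def inj_on_def)
  \<comment> \<open>A kernel vector of \<open>M'\<close>, which is \<open>t\<close> times the
    identity minus \<open>M\<close>, would be an eigenvector of \<open>M\<close> for
    \<open>t\<close>.\<close>
  have "\<not> eigenvalue ?A 0"
  proof
    assume "eigenvalue ?A 0"
    then have "0 \<in> eigenvalues_on I M'"
      by (simp add: eigenvalues_on_reindex[OF h])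
    then obtain v where v: "\<exists>i\<in>I. v i \<noteq> 0" "\<forall>i\<in>I. (\<Sum>j\<in>I. M' i j * v j) = 0"
      unfolding eigenvalues_on_def by auto
    have "(\<Sum>j\<in>I. M i j * v j) = t * v i" if "i \<in> I" for i
    proof -
      have "(\<Sum>j\<in>I. M' i j * v j) = (\<Sum>j\<in>I. (if i = j then t * v j else 0)) - (\<Sum>j\<in>I. M i j * v j)"
        unfolding sum_subtractf[symmetric] by (rule sum.cong) (auto simp: M'_def algebra_simps)
      then show ?thesis using v(2) that \<open>finite I\<close> by simp
    qed
    then have "t \<in> eigenvalues_on I M"
      using v(1) unfolding eigenvalues_on_def by blast
    with t show False ..
  qed
  moreover have "char_matrix ?A 0 = ?A"
    by (intro eq_matI) (auto simp: char_matrix_def)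
  ultimately have "Determinant.det ?A \<noteq> 0"
    using eigenvalue_det[OF A, of 0] by simp
  \<comment> \<open>The argument \<open>"()"\<close> only fills the extension slot of the matrix
    ring record.\<close>
  from det_non_zero_imp_unit[OF A this, of "()"]
  obtain B where B: "B \<in> carrier_mat n n" and BA: "B * ?A = 1\<^sub>m n"
    unfolding Units_def ring_mat_def by auto
  define k where "k = inv_into {..<n} h"
  have k: "k (h i) = i" if "i < n" for i
    using that h by (simp add: k_def bij_betw_def)
  \<comment> \<open>The inverse matrix \<open>B\<close>, relabelled from numbers back to elements of
    \<open>I\<close>.\<close>
  define G where "G i j = B $$ (k i, k j)" for i j
  have BG: "B = mat n n (\<lambda>(i, j). G (h i) (h j))"
    using B by (intro eq_matI) (auto simp: G_def k)
  show ?thesis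
  proof (intro exI allI impI ballI)
    fix b r i assume eq: "\<forall>i\<in>I. t * b i = (\<Sum>j\<in>I. M i j * b j) + r i" and "i \<in> I"
    let ?b = "vec n (\<lambda>i. b (h i))" and ?r = "vec n (\<lambda>i. r (h i))"
    have "?A *\<^sub>v ?b = ?r"
    proof (rule eq_vecI)
      fix i assume "i < dim_vec ?r"
      then have i: "i < n" by simp
      then have hi: "h i \<in> I" using h by (auto simp: bij_betw_def)
      have "vec_index (?A *\<^sub>v ?b) i = (\<Sum>j\<in>I. M' (h i) j * b j)"
        by (rule mat_mult_vec_reindex[OF h i])
      also have "\<dots> = (\<Sum>j\<in>I. (if h i = j then t * b j else 0)) - (\<Sum>j\<in>I. M (h i) j * b j)"
        unfolding sum_subtractf[symmetric] by (rule sum.cong) (auto simp: M'_def algebra_simps)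
      also have "\<dots> = r (h i)"
        using eq hi \<open>finite I\<close> by simp
      finally show "vec_index (?A *\<^sub>v ?b) i = vec_index ?r i"
        using i by simp
    qed simp
    moreover have "?b = B *\<^sub>v (?A *\<^sub>v ?b)"
      using assoc_mult_mat_vec[OF B A, of ?b] by (simp add: BA)
    ultimately have bB: "?b = B *\<^sub>v ?r" by simp
    obtain l where l: "l < n" "i = h l"
      using \<open>i \<in> I\<close> h by (auto simp: bij_betw_def)
    have "b i = vec_index ?b l"
      using l by simp
    also have "\<dots> = vec_index (B *\<^sub>v ?r) l"
      using bB by simp
    also have "\<dots> = (\<Sum>j\<in>I. G i j * r j)"
      using mat_mult_vec_reindex[OF h l(1), of G r] by (simp add: BG[symmetric] l(2))
    finally show "b i = (\<Sum>j\<in>I. G i j * r j)" .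
  qed
qed

section \<open>Monomials and the zeros of systems with leading terms \<open>t x_i^m\<close>\<close>

definition monomial_at :: "('n::finite \<Rightarrow> nat) \<Rightarrow> real ^ 'n \<Rightarrow> real" where
  "monomial_at \<gamma> x = (\<Prod>l\<in>UNIV. (x $ l) ^ \<gamma> l)"

lemma monomial_at_add: "monomial_at (\<lambda>l. \<gamma> l + \<delta> l) x = monomial_at \<gamma> x * monomial_at \<delta> x"
  by (simp add: monomial_at_def power_add prod.distrib)

lemma monomial_at_single: "monomial_at (\<lambda>l. if l = i then k else 0) x = (x $ i) ^ k"
proof -
  have "monomial_at (\<lambda>l. if l = i then k else 0) x = (\<Prod>l\<in>UNIV. if l = i then (x $ i) ^ k else 1)"
    unfolding monomial_at_def by (rule prod.cong) auto
  then show ?thesis by simp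
qed

lemma finite_bounded_multiindices: "finite {\<gamma> :: 'n::finite \<Rightarrow> nat. (\<Sum>l\<in>UNIV. \<gamma> l) \<le> d}"
proof (rule finite_subset)
  have "\<gamma> l \<le> (\<Sum>l\<in>UNIV. \<gamma> l)" for \<gamma> :: "'n \<Rightarrow> nat" and l
    by (rule member_le_sum) auto
  then show "{\<gamma> :: 'n \<Rightarrow> nat. (\<Sum>l\<in>UNIV. \<gamma> l) \<le> d} \<subseteq> PiE UNIV (\<lambda>_. {..d})"
    using order_trans by fastforce
qed (simp add: finite_PiE)

definition reduced_exponents :: "nat \<Rightarrow> ('n::finite \<Rightarrow> nat) set" where
  "reduced_exponents m = {\<gamma>. \<forall>l. \<gamma> l < m}"

lemma finite_reduced_exponents: "finite (reduced_exponents m)"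
proof (rule finite_subset)
  show "reduced_exponents m \<subseteq> PiE UNIV (\<lambda>_. {..<m})" by (auto simp: reduced_exponents_def)
qed (simp add: finite_PiE)

text \<open>The right-hand sides are sums over arbitrary index sets \<open>K i\<close>, not over
  exponents, so a monomial may occur several times and tensor entries can be used as terms
  directly.\<close>

definition power_system_zeros ::
    "nat \<Rightarrow> ('n::finite \<Rightarrow> 'k set) \<Rightarrow> ('n \<Rightarrow> 'k \<Rightarrow> real) \<Rightarrow> ('n \<Rightarrow> 'k \<Rightarrow> 'n \<Rightarrow> nat) \<Rightarrow> real \<Rightarrow> (real ^ 'n) set"
  where "power_system_zeros m K c \<delta> t =
    {x. \<forall>i. t * (x $ i) ^ m = (\<Sum>k\<in>K i. c i k * monomial_at (\<delta> i k) x)}"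

text \<open>The order of the quantifiers is the point: \<open>T\<close> serves every
  \<open>t\<close>, and \<open>H\<close> depends on \<open>t\<close> but not on the zero
  \<open>x\<close>. The set \<open>T\<close> consists of the eigenvalues of the matrix
  \<open>C\<close> built below.\<close>

lemma monomials_reduce:
  fixes K :: "'n::finite \<Rightarrow> 'k set" and c :: "'n \<Rightarrow> 'k \<Rightarrow> real" and \<delta> :: "'n \<Rightarrow> 'k \<Rightarrow> 'n \<Rightarrow> nat"
  assumes K: "\<And>i. finite (K i)"
    and deg: "\<And>i k. k \<in> K i \<Longrightarrow> (\<Sum>l\<in>UNIV. \<delta> i k l) \<le> m"
  defines "Z \<equiv> power_system_zeros m K c \<delta>"
  defines "S \<equiv> reduced_exponents m :: ('n \<Rightarrow> nat) set"
  shows "\<exists>T. finite T \<and> (\<forall>t. t \<notin> T \<longrightarrow>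
           (\<exists>H. \<forall>x\<in>Z t. \<forall>\<gamma>. (\<Sum>l\<in>UNIV. \<gamma> l) \<le> d \<longrightarrow>
                  monomial_at \<gamma> x = (\<Sum>\<eta>\<in>S. H \<gamma> \<eta> * monomial_at \<eta> x)))"
proof -
  define W where "W = {\<gamma> :: 'n \<Rightarrow> nat. (\<Sum>l\<in>UNIV. \<gamma> l) \<le> d}"
  define B where "B = W - S"
  have finW: "finite W"
    unfolding W_def by (rule finite_bounded_multiindices)
  then have finB: "finite B"
    by (simp add: B_def)
  have finS: "finite S"
    unfolding S_def by (rule finite_reduced_exponents)
  \<comment> \<open>On \<open>B\<close> this picks a coordinate whose \<open>m\<close>-th power
    divides the monomial.\<close>
  define p where "p \<gamma> = (SOME l. m \<le> \<gamma> l)" for \<gamma> :: "'n \<Rightarrow> nat"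
  have p: "m \<le> \<gamma> (p \<gamma>)" if "\<gamma> \<in> B" for \<gamma>
    unfolding p_def using that by (intro someI_ex[of "\<lambda>l. m \<le> \<gamma> l"]) (auto simp: B_def S_def reduced_exponents_def not_less)
  \<comment> \<open>The exponent of the cofactor of that power; the truncated subtraction is exact
    on \<open>B\<close>.\<close>
  define rest where "rest \<gamma> = (\<lambda>l. \<gamma> l - (if l = p \<gamma> then m else 0))" for \<gamma>
  have rest: "(\<lambda>l. rest \<gamma> l + (if l = p \<gamma> then m else 0)) = \<gamma>" if "\<gamma> \<in> B" for \<gamma>
    using p[OF that] by (auto simp: rest_def fun_eq_iff)
  define red where "red \<gamma> k = (\<lambda>l. rest \<gamma> l + \<delta> (p \<gamma>) k l)" for \<gamma> k
  \<comment> \<open>Replacing the power of degree \<open>m\<close> by a term of degree at most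
    \<open>m\<close> does not raise the degree, so the rewriting stays inside the finite set
    \<open>W\<close>.\<close>
  have red: "red \<gamma> k \<in> W" if "\<gamma> \<in> B" "k \<in> K (p \<gamma>)" for \<gamma> k
  proof -
    have "(\<Sum>l\<in>UNIV. \<gamma> l) = (\<Sum>l\<in>UNIV. rest \<gamma> l + (if l = p \<gamma> then m else 0))"
      by (subst rest[OF that(1)]) (rule refl)
    then have "(\<Sum>l\<in>UNIV. rest \<gamma> l) + m = (\<Sum>l\<in>UNIV. \<gamma> l)"
      by (simp add: sum.distrib)
    moreover have "(\<Sum>l\<in>UNIV. red \<gamma> k l) = (\<Sum>l\<in>UNIV. rest \<gamma> l) + (\<Sum>l\<in>UNIV. \<delta> (p \<gamma>) k l)"
      by (simp add: red_def sum.distrib)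
    ultimately show ?thesis
      using deg[OF that(2)] that(1) by (simp add: W_def B_def)
  qed
  \<comment> \<open>Different terms \<open>k\<close> may lead to the same exponent, so their
    coefficients are added up.\<close>
  define C where "C \<gamma> \<eta> = (\<Sum>k\<in>K (p \<gamma>). if red \<gamma> k = \<eta> then c (p \<gamma>) k else 0)" for \<gamma> \<eta>
  have C: "t * monomial_at \<gamma> x = (\<Sum>\<eta>\<in>W. C \<gamma> \<eta> * monomial_at \<eta> x)"
    if "x \<in> Z t" "\<gamma> \<in> B" for t x \<gamma>
  proof -
    have "t * monomial_at \<gamma> x
            = t * monomial_at (\<lambda>l. rest \<gamma> l + (if l = p \<gamma> then m else 0)) x"
      by (subst rest[OF that(2)]) (rule refl)
    also have "\<dots> = monomial_at (rest \<gamma>) x * (t * (x $ p \<gamma>) ^ m)"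
      by (simp add: monomial_at_add monomial_at_single)
    also have "\<dots> = (\<Sum>k\<in>K (p \<gamma>). c (p \<gamma>) k * monomial_at (red \<gamma> k) x)"
      using that(1) by (simp add: Z_def power_system_zeros_def sum_distrib_left red_def monomial_at_add mult_ac)
    also have "\<dots> = (\<Sum>k\<in>K (p \<gamma>). \<Sum>\<eta>\<in>W. if red \<gamma> k = \<eta> then c (p \<gamma>) k * monomial_at \<eta> x else 0)"
      using red[OF that(2)] finW by (intro sum.cong) auto
    also have "\<dots> = (\<Sum>\<eta>\<in>W. \<Sum>k\<in>K (p \<gamma>). if red \<gamma> k = \<eta> then c (p \<gamma>) k * monomial_at \<eta> x else 0)"
      by (rule sum.swap)
    also have "\<dots> = (\<Sum>\<eta>\<in>W. C \<gamma> \<eta> * monomial_at \<eta> x)"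
      unfolding C_def sum_distrib_right by (intro sum.cong) auto
    finally show ?thesis .
  qed
  have "\<exists>H. \<forall>x\<in>Z t. \<forall>\<gamma>. (\<Sum>l\<in>UNIV. \<gamma> l) \<le> d \<longrightarrow> monomial_at \<gamma> x = (\<Sum>\<eta>\<in>S. H \<gamma> \<eta> * monomial_at \<eta> x)"
    if t: "t \<notin> eigenvalues_on B C" for t
  proof -
    obtain G where G: "\<forall>b r. (\<forall>\<gamma>\<in>B. t * b \<gamma> = (\<Sum>\<gamma>'\<in>B. C \<gamma> \<gamma>' * b \<gamma>') + r \<gamma>) \<longrightarrow>
        (\<forall>\<gamma>\<in>B. b \<gamma> = (\<Sum>\<gamma>'\<in>B. G \<gamma> \<gamma>' * r \<gamma>'))"
      using resolvent_on[OF finB t] by (rule exE)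
    \<comment> \<open>A reduced monomial represents itself. The others are obtained by applying the
      resolvent \<open>G\<close> to the columns of \<open>C\<close> in \<open>S\<close>; columns
      outside \<open>W\<close> are set to zero, as \<open>S\<close> need not lie in
      \<open>W\<close>.\<close>
    define H where "H \<gamma> \<eta> = (if \<gamma> \<in> S then (if \<gamma> = \<eta> then 1 else 0)
        else (\<Sum>\<gamma>'\<in>B. G \<gamma> \<gamma>' * (if \<eta> \<in> W then C \<gamma>' \<eta> else 0)))" for \<gamma> \<eta>
    have "monomial_at \<gamma> x = (\<Sum>\<eta>\<in>S. H \<gamma> \<eta> * monomial_at \<eta> x)" if x: "x \<in> Z t" and "\<gamma> \<in> W" for x \<gamma>
    proof (cases "\<gamma> \<in> S")
      case True
      then have "(\<Sum>\<eta>\<in>S. H \<gamma> \<eta> * monomial_at \<eta> x) = (\<Sum>\<eta>\<in>S. if \<gamma> = \<eta> then monomial_at \<eta> x else 0)"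
        by (intro sum.cong) (auto simp: H_def)
      then show ?thesis
        using True finS by simp
    next
      case False
      \<comment> \<open>The contribution of the reduced monomials, which is the inhomogeneous part
        of the linear system for those in \<open>B\<close>.\<close>
      define r where "r \<gamma> = (\<Sum>\<eta>\<in>S. (if \<eta> \<in> W then C \<gamma> \<eta> else 0) * monomial_at \<eta> x)" for \<gamma>
      have "t * monomial_at \<gamma> x = (\<Sum>\<gamma>'\<in>B. C \<gamma> \<gamma>' * monomial_at \<gamma>' x) + r \<gamma>" if "\<gamma> \<in> B" for \<gamma>
      proof -
        have "r \<gamma> = (\<Sum>\<eta>\<in>W \<inter> S. C \<gamma> \<eta> * monomial_at \<eta> x)"
          unfolding r_def using finS by (intro sum.mono_neutral_cong_right) auto
        moreover have "(\<Sum>\<eta>\<in>W. C \<gamma> \<eta> * monomial_at \<eta> x) =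
            (\<Sum>\<eta>\<in>W \<inter> S. C \<gamma> \<eta> * monomial_at \<eta> x) + (\<Sum>\<eta>\<in>B. C \<gamma> \<eta> * monomial_at \<eta> x)"
          unfolding B_def by (rule sum.Int_Diff[OF finW])
        ultimately show ?thesis
          using C[OF x that] by simp
      qed
      then have "monomial_at \<gamma> x = (\<Sum>\<gamma>'\<in>B. G \<gamma> \<gamma>' * r \<gamma>')"
        using G[rule_format, of "\<lambda>\<gamma>. monomial_at \<gamma> x" r \<gamma>] False \<open>\<gamma> \<in> W\<close> by (simp add: B_def)
      also have "\<dots> = (\<Sum>\<gamma>'\<in>B. \<Sum>\<eta>\<in>S. G \<gamma> \<gamma>' * (if \<eta> \<in> W then C \<gamma>' \<eta> else 0) * monomial_at \<eta> x)"
        by (simp only: r_def sum_distrib_left mult.assoc)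
      also have "\<dots> = (\<Sum>\<eta>\<in>S. H \<gamma> \<eta> * monomial_at \<eta> x)"
        using False by (subst sum.swap) (simp only: H_def sum_distrib_right if_False)
      finally show ?thesis .
    qed
    then show ?thesis
      by (intro exI[of _ H]) (simp add: W_def)
  qed
  then show ?thesis
    using eigenvalues_on_bound(1)[OF finB, of C] by (intro exI[of _ "eigenvalues_on B C"]) simp
qed

text \<open>Each coordinate of a zero is an eigenvalue of a matrix of size \<open>card S\<close>,
  which leaves at most \<open>card S\<close> values per coordinate. This count does not involve
  \<open>t\<close>.\<close>

lemma power_system_zeros_bounded:
  fixes K :: "'n::finite \<Rightarrow> 'k set" and c :: "'n \<Rightarrow> 'k \<Rightarrow> real" and \<delta> :: "'n \<Rightarrow> 'k \<Rightarrow> 'n \<Rightarrow> nat"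
  assumes m: "0 < m"
    and K: "\<And>i. finite (K i)"
    and deg: "\<And>i k. k \<in> K i \<Longrightarrow> (\<Sum>l\<in>UNIV. \<delta> i k l) \<le> m"
  shows "\<exists>N T. finite T \<and> (\<forall>t. t \<notin> T \<longrightarrow>
           finite (power_system_zeros m K c \<delta> t) \<and> card (power_system_zeros m K c \<delta> t) \<le> N)"
proof -
  define S where "S = (reduced_exponents m :: ('n \<Rightarrow> nat) set)"
  define Z where "Z = power_system_zeros m K c \<delta>"
  have finS: "finite S"
    unfolding S_def by (rule finite_reduced_exponents)
  \<comment> \<open>A reduced exponent has total degree at most \<open>CARD('n) * m\<close>; one
    more accounts for the multiplication by a variable.\<close>
  define d where "d = CARD('n) * m + 1"
  have "\<exists>T. finite T \<and> (\<forall>t. t \<notin> T \<longrightarrow> (\<exists>H. \<forall>x\<in>Z t. \<forall>\<gamma>. (\<Sum>l\<in>UNIV. \<gamma> l) \<le> d \<longrightarrow>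
      monomial_at \<gamma> x = (\<Sum>\<eta>\<in>S. H \<gamma> \<eta> * monomial_at \<eta> x)))"
    unfolding Z_def S_def by (rule monomials_reduce) (auto intro: K deg)
  then obtain T where T: "finite T" "\<forall>t. t \<notin> T \<longrightarrow> (\<exists>H. \<forall>x\<in>Z t. \<forall>\<gamma>. (\<Sum>l\<in>UNIV. \<gamma> l) \<le> d \<longrightarrow>
      monomial_at \<gamma> x = (\<Sum>\<eta>\<in>S. H \<gamma> \<eta> * monomial_at \<eta> x))"
    by (elim exE conjE) (rule that)
  have "finite (Z t) \<and> card (Z t) \<le> card S ^ CARD('n)" if "t \<notin> T" for t
  proof -
    obtain H where "\<forall>x\<in>Z t. \<forall>\<gamma>. (\<Sum>l\<in>UNIV. \<gamma> l) \<le> d \<longrightarrow>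
        monomial_at \<gamma> x = (\<Sum>\<eta>\<in>S. H \<gamma> \<eta> * monomial_at \<eta> x)"
      using T(2)[rule_format, OF \<open>t \<notin> T\<close>] by (rule exE)
    note H = this[rule_format]
    \<comment> \<open>Row \<open>\<gamma>\<close> expands \<open>x $ i\<close> times the monomial of
      \<open>\<gamma>\<close> in reduced monomials.\<close>
    define M where "M i \<gamma> = H (\<lambda>l. \<gamma> l + (if l = i then 1 else 0))" for i \<gamma>
    define E where "E i = eigenvalues_on S (M i)" for i
    have "x $ i \<in> E i" if x: "x \<in> Z t" for x i
    proof -
      have "(\<Sum>\<eta>\<in>S. M i \<gamma> \<eta> * monomial_at \<eta> x) = x $ i * monomial_at \<gamma> x" if "\<gamma> \<in> S" for \<gamma>
      proof -
        have "(\<Sum>l\<in>UNIV. \<gamma> l) \<le> (\<Sum>l\<in>(UNIV :: 'n set). m)"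
          using that by (intro sum_mono) (auto simp: S_def reduced_exponents_def intro: less_imp_le)
        then have "(\<Sum>l\<in>UNIV. \<gamma> l + (if l = i then 1 else 0)) \<le> d"
          by (simp add: d_def sum.distrib)
        from H[OF x this] show ?thesis
          by (simp add: M_def monomial_at_add monomial_at_single mult.commute)
      qed
      \<comment> \<open>The vector of reduced monomials is a genuine eigenvector: it contains the
        constant monomial 1, whose exponent is reduced because \<open>0 < m\<close>.\<close>
      moreover have "(\<lambda>_. 0) \<in> S" "monomial_at (\<lambda>_. 0) x \<noteq> 0"
        using m by (auto simp: S_def reduced_exponents_def monomial_at_def)
      ultimately show ?thesis
        unfolding E_def eigenvalues_on_def
        by (intro CollectI exI[of _ "\<lambda>\<gamma>. monomial_at \<gamma> x"]) (auto intro!: bexI[of _ "\<lambda>_. 0"])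
    qed
    then have sub: "Z t \<subseteq> vec_lambda ` PiE UNIV E"
      by (auto simp: image_iff PiE_def intro!: bexI[of _ "vec_nth _"])
    have finE: "finite (PiE UNIV E)"
      by (intro finite_PiE) (auto simp: E_def eigenvalues_on_bound(1)[OF finS])
    have "card (Z t) \<le> card (vec_lambda ` PiE UNIV E)"
      using sub finE by (intro card_mono) auto
    also have "\<dots> \<le> card (PiE UNIV E)"
      by (rule card_image_le[OF finE])
    also have "\<dots> = (\<Prod>i\<in>UNIV. card (E i))"
      by (simp add: card_PiE)
    also have "\<dots> \<le> (\<Prod>i\<in>(UNIV :: 'n set). card S)"
      by (intro prod_mono) (auto simp: E_def eigenvalues_on_bound(2)[OF finS])
    finally show ?thesis
      using finite_subset[OF sub] finE by simp
  qed
  then show ?thesis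
    using T(1) unfolding Z_def by blast
qed

section \<open>Diagonal perturbation of the complementarity problem\<close>

definition diagonal_tensor :: "('m::{finite,linorder}, 'n::finite) tensor" where
  "diagonal_tensor = (\<chi> j. if \<forall>k. j $ k = j $ first_pos then 1 else 0)"

lemma tensor_apply_perturb:
  "tensor_apply (A + t *\<^sub>R D) x = tensor_apply A x + t *\<^sub>R tensor_apply D x"
  by (simp add: tensor_apply_def Finite_Cartesian_Product.vec_eq_iff algebra_simps sum.distrib sum_distrib_left)

text \<open>The factor \<open>x $ i\<close> fills the missing first position, so that every position
  contributes to the product.\<close>

lemma component_times_tensor_apply:
  fixes A :: "('m::{finite,linorder}, 'n::finite) tensor"
  shows "x $ i * tensor_apply A x $ i = (\<Sum>j | j $ first_pos = i. A $ j * (\<Prod>k\<in>UNIV. x $ (j $ k)))"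
proof -
  have "(\<Prod>k\<in>UNIV. x $ (j $ k)) = x $ i * (\<Prod>k\<in>UNIV - {first_pos}. x $ (j $ k))"
    if "j $ first_pos = i" for j :: "'n ^ ('m::{finite,linorder})"
    using that by (subst prod.remove[of _ first_pos]) auto
  then show ?thesis
    by (simp add: tensor_apply_def sum_distrib_left mult_ac)
qed

text \<open>Among the multi-indices starting with \<open>i\<close>, only the constant one carries a
  nonzero entry.\<close>

lemma component_times_diagonal_apply:
  "x $ i * tensor_apply (diagonal_tensor :: ('m::{finite,linorder}, 'n::finite) tensor) x $ i
     = (x $ i) ^ CARD('m)"
proof -
  have "(\<Sum>j | j $ first_pos = i. (diagonal_tensor :: ('m, 'n) tensor) $ j * (\<Prod>k\<in>UNIV. x $ (j $ k)))
      = (\<Sum>j\<in>{(\<chi> k. i) :: 'n ^ ('m::{finite,linorder})}. (\<Prod>k\<in>UNIV. x $ (j $ k)))"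
    by (intro sum.mono_neutral_cong_right) (auto simp: diagonal_tensor_def Finite_Cartesian_Product.vec_eq_iff)
  then show ?thesis
    by (simp add: component_times_tensor_apply)
qed

lemma prod_eq_monomial_at:
  fixes j :: "'n::finite ^ 'm::finite"
  shows "(\<Prod>k\<in>UNIV. x $ (j $ k)) = monomial_at (\<lambda>l. card {k. j $ k = l}) x"
proof -
  have "(\<Prod>k\<in>UNIV. x $ (j $ k)) = (\<Prod>l\<in>UNIV. \<Prod>k\<in>{k. j $ k = l}. x $ (j $ k))"
    using prod.group[of UNIV UNIV "\<lambda>k. j $ k" "\<lambda>k. x $ (j $ k)"] by simp
  then show ?thesis
    by (simp add: monomial_at_def)
qed

lemma sum_card_fibres:
  fixes j :: "'n::finite ^ 'm::finite"
  shows "(\<Sum>l\<in>UNIV. card {k. j $ k = l}) = CARD('m)"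
  using sum.group[of UNIV UNIV "\<lambda>k. j $ k" "\<lambda>_. 1 :: nat"] by simp

text \<open>The orthogonality condition is a vanishing sum of nonnegative terms, so each term
  vanishes.\<close>

lemma Sol_complementarity:
  assumes "x \<in> Sol (A, a)"
  shows "x $ i * (tensor_apply A x $ i + a $ i) = 0"
proof -
  have nonneg: "0 \<le> x $ l * (tensor_apply A x $ l + a $ l)" for l
    using assms by (simp add: Sol_def)
  have "(\<Sum>l\<in>UNIV. x $ l * (tensor_apply A x $ l + a $ l)) = 0"
    using assms by (simp add: Sol_def tensor_form_def inner_vec_def algebra_simps sum.distrib)
  then show ?thesis
    using nonneg by (simp add: sum_nonneg_eq_0_iff)
qed

text \<open>Componentwise complementarity, solved for \<open>t * (x $ i) ^ CARD('m)\<close>, is a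
  power system. Keeping only these equations gives an inclusion, which suffices for an upper
  bound.\<close>

lemma perturbed_Sol_bounded:
  fixes A :: "('m::{finite,linorder}, 'n::finite) tensor" and a :: "real ^ 'n"
  shows "\<exists>N T. finite T \<and> (\<forall>t. t \<notin> T \<longrightarrow>
           finite (Sol (A + t *\<^sub>R diagonal_tensor, a)) \<and> card (Sol (A + t *\<^sub>R diagonal_tensor, a)) \<le> N)"
proof -
  define J where "J i = {j :: 'n ^ ('m::{finite,linorder}). j $ first_pos = i}" for i
  \<comment> \<open>\<open>None\<close> stands for the linear term from \<open>a $ i\<close>, and
    \<open>Some j\<close> for the term of the tensor entry at \<open>j\<close>.\<close>
  define K where "K i = insert None (Some ` J i)" for i
  define c where "c i k = - (case k of None \<Rightarrow> a $ i | Some j \<Rightarrow> A $ j)" for i :: 'n and k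
  define \<delta> :: "'n \<Rightarrow> ('n ^ ('m::{finite,linorder})) option \<Rightarrow> 'n \<Rightarrow> nat"
    where "\<delta> i k = (case k of None \<Rightarrow> (\<lambda>l. if l = i then 1 else 0) | Some j \<Rightarrow> (\<lambda>l. card {k. j $ k = l}))"
    for i k
  define Z where "Z = power_system_zeros CARD('m) K c \<delta>"
  have "0 < CARD('m)" by simp
  moreover have "finite (K i)" for i
    by (simp add: K_def)
  moreover have "(\<Sum>l\<in>UNIV. \<delta> i k l) \<le> CARD('m)" if "k \<in> K i" for i k
    using that by (auto simp: K_def \<delta>_def sum_card_fibres Suc_le_eq)
  ultimately obtain N T where NT: "finite T" "\<And>t. t \<notin> T \<Longrightarrow> finite (Z t) \<and> card (Z t) \<le> N"
    using power_system_zeros_bounded[of "CARD('m)" K \<delta> c] unfolding Z_def by blast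
  have sub: "Sol (A + t *\<^sub>R diagonal_tensor, a) \<subseteq> Z t" for t
  proof
    fix x assume x: "x \<in> Sol (A + t *\<^sub>R diagonal_tensor, a)"
    have "t * (x $ i) ^ CARD('m) = (\<Sum>k\<in>K i. c i k * monomial_at (\<delta> i k) x)" for i
    proof -
      have "(\<Sum>k\<in>K i. c i k * monomial_at (\<delta> i k) x)
          = - (a $ i * x $ i) - (\<Sum>j\<in>J i. A $ j * (\<Prod>k\<in>UNIV. x $ (j $ k)))"
        unfolding K_def
        by (subst sum.insert)
          (auto simp: sum.reindex c_def \<delta>_def monomial_at_single prod_eq_monomial_at sum_negf)
      also have "\<dots> = - (a $ i * x $ i) - x $ i * tensor_apply A x $ i"
        by (simp add: component_times_tensor_apply J_def)
      also have "\<dots> = t * (x $ i * tensor_apply (diagonal_tensor :: ('m, 'n) tensor) x $ i)"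
        using Sol_complementarity[OF x, of i] by (simp add: tensor_apply_perturb algebra_simps)
      finally show ?thesis
        by (simp add: component_times_diagonal_apply)
    qed
    then show "x \<in> Z t" by (simp add: Z_def power_system_zeros_def)
  qed
  have "finite (Sol (A + t *\<^sub>R diagonal_tensor, a)) \<and> card (Sol (A + t *\<^sub>R diagonal_tensor, a)) \<le> N"
    if "t \<notin> T" for t
    using NT(2)[OF that] finite_subset[OF sub, of t] card_mono[OF _ sub, of t] by linarith
  then show ?thesis
    using NT(1) by blast
qed

section \<open>Counting solutions under lower semicontinuity\<close>

text \<open>Distinct points of \<open>F\<close> have disjoint neighbourhoods, so the sequences
  approaching them are eventually pairwise distinct and embed \<open>F\<close> into
  \<open>\<Psi> (X k)\<close>. Finiteness is a premise because \<open>card\<close> is 0 on infinite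
  sets.\<close>

lemma eventually_card_ge_if_set_liminf:
  fixes \<Psi> :: "'a::topological_space \<Rightarrow> 'b::t2_space set"
  assumes F: "finite F" "F \<subseteq> set_liminf \<Psi> x" and X: "X \<longlonglongrightarrow> x"
  shows "\<forall>\<^sub>F k in sequentially. finite (\<Psi> (X k)) \<longrightarrow> card F \<le> card (\<Psi> (X k))"
proof -
  have "\<forall>v\<in>F. \<exists>u. u \<longlonglongrightarrow> v \<and> (\<forall>\<^sub>F k in sequentially. u k \<in> \<Psi> (X k))"
    using F(2) X by (auto simp: set_liminf_def)
  then obtain u where u: "\<And>v. v \<in> F \<Longrightarrow> u v \<longlonglongrightarrow> v"
      "\<And>v. v \<in> F \<Longrightarrow> \<forall>\<^sub>F k in sequentially. u v k \<in> \<Psi> (X k)"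
    by metis
  have "\<forall>\<^sub>F k in sequentially. u v k \<noteq> u w k" if vw: "v \<in> F" "w \<in> F" "v \<noteq> w" for v w
  proof -
    obtain U V where UV: "open U" "open V" "v \<in> U" "w \<in> V" "U \<inter> V = {}"
      using hausdorff[OF vw(3)] by blast
    have "\<forall>\<^sub>F k in sequentially. u v k \<in> U" "\<forall>\<^sub>F k in sequentially. u w k \<in> V"
      using u(1) vw UV by (auto intro: topological_tendstoD)
    then show ?thesis
      by eventually_elim (use UV(5) in auto)
  qed
  then have "\<forall>\<^sub>F k in sequentially. \<forall>v\<in>F. \<forall>w\<in>F. v \<noteq> w \<longrightarrow> u v k \<noteq> u w k"
    using F(1) by (auto simp: eventually_ball_finite_distrib)
  moreover have "\<forall>\<^sub>F k in sequentially. \<forall>v\<in>F. u v k \<in> \<Psi> (X k)"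
    using F(1) u(2) by (auto simp: eventually_ball_finite_distrib)
  ultimately show ?thesis
  proof eventually_elim
    case (elim k)
    then have "inj_on (\<lambda>v. u v k) F" "(\<lambda>v. u v k) ` F \<subseteq> \<Psi> (X k)"
      by (auto simp: inj_on_def)
    then show ?case
      by (auto intro: card_inj_on_le)
  qed
qed

lemma finite_Sol_if_lower_semicontinuous:
  fixes A :: "('m::{finite,linorder}, 'n::finite) tensor"
  assumes "lower_semicontinuous_at Sol (A, a)"
  shows "finite (Sol (A, a))"
proof (rule ccontr)
  assume inf: "infinite (Sol (A, a))"
  obtain N T where NT: "finite T" "\<And>t. t \<notin> T \<Longrightarrow> finite (Sol (A + t *\<^sub>R diagonal_tensor, a)) \<and>
      card (Sol (A + t *\<^sub>R diagonal_tensor, a)) \<le> N"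
    using perturbed_Sol_bounded[of A a] by blast
  \<comment> \<open>One point more than the bound \<open>N\<close> allows.\<close>
  obtain F where F: "finite F" "card F = Suc N" "F \<subseteq> Sol (A, a)"
    using infinite_arbitrarily_large[OF inf] by blast
  define t :: "nat \<Rightarrow> real" where "t k = inverse (real (Suc k))" for k
  have "(\<lambda>k. (A + t k *\<^sub>R diagonal_tensor, a)) \<longlonglongrightarrow> (A + 0 *\<^sub>R diagonal_tensor, a)"
    unfolding t_def by (intro tendsto_intros LIMSEQ_inverse_real_of_nat)
  then have lim: "(\<lambda>k. (A + t k *\<^sub>R diagonal_tensor, a)) \<longlonglongrightarrow> (A, a)"
    by simp
  have "F \<subseteq> set_liminf Sol (A, a)"
    using F(3) assms by (simp add: lower_semicontinuous_at_def)
  from eventually_card_ge_if_set_liminf[OF F(1) this lim]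
  have ev: "\<forall>\<^sub>F k in sequentially. finite (Sol (A + t k *\<^sub>R diagonal_tensor, a)) \<longrightarrow>
      card F \<le> card (Sol (A + t k *\<^sub>R diagonal_tensor, a))" .
  \<comment> \<open>An injective sequence meets the finite exceptional set \<open>T\<close> only
    finitely often.\<close>
  have "inj t"
    by (auto simp: t_def inj_on_def)
  then have "finite {k. t k \<in> T}"
    using finite_vimageI[OF NT(1)] by (simp add: vimage_def)
  then have "\<forall>\<^sub>F k in sequentially. t k \<notin> T"
    by (simp add: cofinite_eq_sequentially[symmetric] eventually_cofinite)
  with ev have "\<forall>\<^sub>F k in sequentially. False"
  proof eventually_elim
    case (elim k)
    then show ?case using NT(2)[of "t k"] F(2) by force
  qed
  then show False by simp
qed

section \<open>Dimension of finite semi-algebraic sets\<close>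

lemma real_polynomial_function_inner_diff:
  "real_polynomial_function (\<lambda>x::'a::euclidean_space. x \<bullet> b - c)"
  by (intro real_polynomial_function_diff) (auto intro: real_polynomial_function.intros bounded_linear_inner_left)

lemma semialgebraic_singleton: "semialgebraic {z :: 'a::euclidean_space}"
proof -
  have "{z} = {x. (\<forall>p\<in>(\<lambda>b x. x \<bullet> b - z \<bullet> b) ` Basis. p x = 0) \<and> (\<forall>p\<in>{}. 0 < p x)}"
    by (auto intro: euclidean_eqI)
  then have "basic_semialgebraic {z}"
    unfolding basic_semialgebraic_def
    by (intro exI[of _ "(\<lambda>b x. x \<bullet> b - z \<bullet> b) ` Basis"] exI[of _ "{}"])
      (auto simp: real_polynomial_function_inner_diff)
  then show ?thesis
    unfolding semialgebraic_def by (intro exI[of _ "{{z}}"]) auto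
qed

lemma Ck_on_const: "Ck_on k (\<lambda>_. c) U"
  by (induction k arbitrary: c) (auto simp: frechet_derivative_const)

lemma smooth_map_on_const: "smooth_map_on X (\<lambda>_. c)"
  unfolding smooth_map_on_def by (intro ballI exI[of _ UNIV] exI[of _ "\<lambda>_. c"]) (auto simp: Ck_on_const)

lemma open_cube_empty: "open_cube {} = {0}"
  by (auto simp: open_cube_def intro: euclidean_eqI)

lemma semialgebraic_cell_singleton: "semialgebraic_cell {z :: 'a::euclidean_space} 0"
proof -
  have "semialgebraic_diffeomorphic {z} (open_cube {} :: 'a set)"
    unfolding semialgebraic_diffeomorphic_def open_cube_empty
    by (intro exI[of _ "\<lambda>_. 0"] exI[of _ "\<lambda>_. z"])
      (simp add: semialgebraic_singleton smooth_map_on_const)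
  then show ?thesis
    unfolding semialgebraic_cell_def by (auto simp: semialgebraic_singleton intro!: exI[of _ "{}"])
qed

text \<open>The cube contains the open diagonal segment from 0 to \<open>\<Sum>B\<close>.\<close>

lemma infinite_open_cube:
  assumes "B \<subseteq> Basis" "b \<in> B"
  shows "infinite (open_cube B)"
proof
  assume fin: "finite (open_cube B)"
  have finB: "finite B"
    using assms(1) finite_Basis by (rule finite_subset)
  have inner: "\<Sum>B \<bullet> c = (if c \<in> B then 1 else 0)" if "c \<in> Basis" for c
  proof -
    have "\<Sum>B \<bullet> c = (\<Sum>b\<in>B. if b = c then 1 else 0)"
      unfolding inner_sum_left using assms(1) that by (intro sum.cong) (auto simp: inner_Basis)
    then show ?thesis using finB by simp
  qed
  let ?f = "\<lambda>s::real. s *\<^sub>R \<Sum>B"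
  have "\<Sum>B \<noteq> 0"
    using inner[of b] assms by auto
  then have "inj_on ?f {0<..<1}"
    by (auto simp: inj_on_def)
  moreover have "?f ` {0<..<1} \<subseteq> open_cube B"
    using inner by (auto simp: open_cube_def)
  ultimately have "finite {0<..<1::real}"
    using fin finite_imageD finite_subset by blast
  then show False
    using infinite_Ioo[of "0::real" 1] by simp
qed

text \<open>The cell is in bijection with its cube, and the only finite cube is the point
  \<open>open_cube {}\<close>.\<close>

lemma semialgebraic_cell_finite:
  assumes "semialgebraic_cell T d" "finite T"
  shows "T \<noteq> {}" "d = 0"
proof -
  obtain B :: "'a set" where B: "B \<subseteq> Basis" "card B = d" "semialgebraic_diffeomorphic T (open_cube B)"
    using assms(1) by (auto simp: semialgebraic_cell_def)
  then obtain f g where fg: "f ` T = open_cube B" "g ` open_cube B = T"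
    by (auto simp: semialgebraic_diffeomorphic_def)
  then have "finite (open_cube B)"
    using assms(2) by (metis finite_imageI)
  then have "B = {}"
    using infinite_open_cube[OF B(1)] by blast
  then show "T \<noteq> {}" "d = 0"
    using B(2) fg by (auto simp: open_cube_empty)
qed

text \<open>The definite description needs both halves: the singletons form a decomposition with
  maximum 0, and in any other one the cells are finite too, hence of dimension 0.\<close>

lemma semialgebraic_dim_finite:
  fixes S :: "'a::euclidean_space set"
  assumes "finite S"
  shows "semialgebraic_dim S \<le> 0"
proof (cases "S = {}")
  case False
  have "(THE k. \<exists>P d. cell_decomposition S P d \<and> k = Max (d ` P)) = 0"
  proof (rule the_equality)
    let ?P = "(\<lambda>z. {z}) ` S"
    have "cell_decomposition S ?P (\<lambda>_. 0)"
      using assms by (auto simp: cell_decomposition_def semialgebraic_cell_singleton disjoint_def)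
    moreover have "0 = Max ((\<lambda>_. 0::nat) ` ?P)"
      using False by (simp add: image_constant_conv)
    ultimately show "\<exists>P d. cell_decomposition S P d \<and> 0 = Max (d ` P)"
      by blast
  next
    fix k assume "\<exists>P d. cell_decomposition S P d \<and> k = Max (d ` P)"
    then obtain P d where P: "cell_decomposition S P d" and k: "k = Max (d ` P)"
      by blast
    have "d T = 0" if "T \<in> P" for T
    proof -
      have "T \<subseteq> S" "semialgebraic_cell T (d T)"
        using P that by (auto simp: cell_decomposition_def)
      then show ?thesis
        using assms by (auto intro: semialgebraic_cell_finite(2) finite_subset)
    qed
    \<comment> \<open>This ensures that \<open>Max\<close> is taken over \<open>{0}\<close> and not
      over the empty set.\<close>
    moreover have "P \<noteq> {}"
      using P False by (auto simp: cell_decomposition_def)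
    ultimately have "d ` P = {0}" by auto
    then show "k = 0" using k by simp
  qed
  then show ?thesis by (simp add: semialgebraic_dim_def)
qed (simp add: semialgebraic_dim_def)

theorem theorem4p1:
  fixes A :: "('m::{finite,linorder}, 'n::finite) tensor" and a :: "real ^ 'n"
  assumes "2 \<le> CARD('m)" and "2 \<le> CARD('n)"
  shows "(lower_semicontinuous_at Sol (A, a) \<longrightarrow> finite (Sol (A, a))) \<and>
         (semialgebraic_dim (Sol (A, a)) \<ge> 1 \<longrightarrow> \<not> lower_semicontinuous_at Sol (A, a))"
  \<comment> \<open>The second claim is the contrapositive of the first, since a finite solution set
    has dimension at most 0.\<close>
  using finite_Sol_if_lower_semicontinuous[of A a] semialgebraic_dim_finite[of "Sol (A, a)"]
  by auto

end
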